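(* Let $f\in C(\mathbb{S}^1)$. Then $\overline V^p(f)\leq V^p(f)$ for all $p\ge1$, and $\overline I(f)=I(f)$.
   Context: $\mathbb{S}^1=[0,1]/_{0\sim 1}$ is the circle and $C(\mathbb{S}^1)$ is the set of continuous real-valued functions on $\mathbb{S}^1$. An excursion function is a continuous $f:[0,1]\to[0,\infty)$ with $f(0)=f(1)=0$. A general $f\in C(\mathbb{S}^1)$ is identified with the excursion function $\widetilde f(x)=f(x+a)-f(a)$, where $a$ is a point at which $f$ attains its minimum; all quantities below for $f\in C(\mathbb{S}^1)$ are understood as those of $\widetilde f$. A finite partition means finitely many points $x_1<x_2<\dots<x_n$ in $[0,1]$. For $p\ge1$: - the $p$-variation is $V^p(f)=\sup\sum_{i=1}^{n-1}|f(x_i)-f(x_{i+1})|^p$, over all finite partitions; the variation index is $I(f)=\sup\{p\ge1: V^p(f)=\infty\}$; - for $r>0$, the $(p,r)$-variation $V_r^p(f)$ is the supremum of $\sum_{i=1}^{n-1}|f(x_i)-f(x_{i+1})|^p$ over all finite partitions with $|f(x_i)-f(x_{i+1})|=r$ for all $1\le i\le n-1$ (the value is $0$ if no such partition with $n\ge2$ exists); - the upper variation content is $\overline V^p(f)=\limsup_{r\to0}V_r^p(f)$ and the upper variation index is $\overline I(f)=\sup\{p\ge1:\overline V^p(f)=\infty\}$. In both indices the supremum of the empty set is taken to be $1$. *)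

theory Defs
  imports Complex_Main "HOL-Library.Extended_Nonnegative_Real"
begin

text \<open>A function on the circle [0,1]/(0 ~ 1) is represented by its restriction to [0,1];
  values outside [0,1] are irrelevant.\<close>

definition circle_continuous :: "(real \<Rightarrow> real) \<Rightarrow> bool" where
  "circle_continuous f \<longleftrightarrow> continuous_on {0..1} f \<and> f 0 = f 1"

definition circle_minimum_at :: "(real \<Rightarrow> real) \<Rightarrow> real \<Rightarrow> bool" where
  "circle_minimum_at f a \<longleftrightarrow> a \<in> {0..1} \<and> (\<forall>x\<in>{0..1}. f a \<le> f x)"

text \<open>Addition on the circle is addition modulo 1, hence \<open>frac\<close>.\<close>

definition excursion :: "(real \<Rightarrow> real) \<Rightarrow> real \<Rightarrow> real \<Rightarrow> real" where
  "excursion f a x = f (frac (x + a)) - f a"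

definition finite_partition :: "real list \<Rightarrow> bool" where
  "finite_partition xs \<longleftrightarrow> sorted_wrt (<) xs \<and> set xs \<subseteq> {0..1}"

definition variation_sum :: "real \<Rightarrow> (real \<Rightarrow> real) \<Rightarrow> real list \<Rightarrow> real" where
  "variation_sum p f xs = (\<Sum>i<length xs - 1. \<bar>f (xs ! i) - f (xs ! Suc i)\<bar> powr p)"

definition p_variation :: "real \<Rightarrow> (real \<Rightarrow> real) \<Rightarrow> ennreal" where
  "p_variation p f = (SUP xs \<in> {xs. finite_partition xs}. ennreal (variation_sum p f xs))"

definition variation_index :: "(real \<Rightarrow> real) \<Rightarrow> ereal" where
  "variation_index f =
     (let P = {p::real. 1 \<le> p \<and> p_variation p f = \<infinity>}
      in if P = {} then 1 else (SUP p \<in> P. ereal p))"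

text \<open>Partitions with at most one point satisfy the step condition vacuously and contribute the
  value 0, so the supremum is 0 if no partition with two or more points qualifies.\<close>

definition pr_variation :: "real \<Rightarrow> real \<Rightarrow> (real \<Rightarrow> real) \<Rightarrow> ennreal" where
  "pr_variation p r f =
     (SUP xs \<in> {xs. finite_partition xs \<and>
                    (\<forall>i < length xs - 1. \<bar>f (xs ! i) - f (xs ! Suc i)\<bar> = r)}.
        ennreal (variation_sum p f xs))"

definition upper_variation_content :: "real \<Rightarrow> (real \<Rightarrow> real) \<Rightarrow> ennreal" where
  "upper_variation_content p f = Limsup (at_right 0) (\<lambda>r. pr_variation p r f)"

definition upper_variation_index :: "(real \<Rightarrow> real) \<Rightarrow> ereal" where
  "upper_variation_index f =
     (let P = {p::real. 1 \<le> p \<and> upper_variation_content p f = \<infinity>}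
      in if P = {} then 1 else (SUP p \<in> P. ereal p))"

end

theory Submission imports Defs begin

text \<open>
  The inequality is immediate: a partition whose increments all have modulus \<open>r\<close> is in particular
  a partition, so each \<open>(p,r)\<close>-variation, and hence their upper limit, is at most the
  \<open>p\<close>-variation. This also gives one half of the equality of the indices.

  The other half is the claim that a finite upper content of order \<open>q\<close> forces a finite
  \<open>p\<close>-variation for all \<open>p > q\<close>. It rests on two ideas.

  The first compares an arbitrary partition with exact ones. Suppose \<open>\<bar>g u - g v\<bar> \<ge> 2 * r\<close> with
  \<open>u < v\<close>, and let \<open>t \<le> u\<close>. Then \<open>g u\<close> and \<open>g v\<close> cannot both be closer than \<open>r\<close> to \<open>g t\<close>, so by
  the intermediate value theorem there is a point of \<open>(t, v]\<close> where \<open>g\<close> differs from \<open>g t\<close> by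
  exactly \<open>r\<close>. As this point is at most \<open>v\<close>, it can serve as the starting point for the next large
  increment. Walking through the partition in this way, one gains an exact step for every increment
  of size at least \<open>2 * r\<close> (\<open>exact_chain\<close>). Thus the number of such increments is at most
  \<open>r powr (-q)\<close> times the \<open>(q,r)\<close>-variation.

  The second is a dyadic summation (\<open>sum_powr_le_of_dyadic_count\<close>). If all increments are at most
  \<open>M\<close> and \<open>O(2 powr (k * q))\<close> of them are at least \<open>M / 2 ^ k\<close>, then the increments whose size is
  comparable to \<open>M / 2 ^ k\<close> contribute \<open>O(2 powr (k * (q - p)))\<close> to the \<open>p\<close>-variation sum, and
  these bounds form a convergent geometric series, uniformly over all partitions.

  Both ideas apply to any continuous function on the closed unit interval. The excursion is one,
  because the end values of \<open>f\<close> agree, so that rotating the circle creates no jump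
  (\<open>continuous_on_excursion\<close>).
\<close>

section \<open>Exact steps from large increments\<close>

lemma exact_step:
  fixes g :: "real \<Rightarrow> real"
  assumes g: "continuous_on {0..1} g" and t: "0 \<le> t" "t \<le> u" and uv: "u < v" "v \<le> 1"
    and r: "0 < r" "2 * r \<le> \<bar>g u - g v\<bar>"
  obtains s where "t < s" "s \<le> v" "\<bar>g t - g s\<bar> = r"
proof -
  have "r \<le> \<bar>g t - g u\<bar> \<or> r \<le> \<bar>g t - g v\<bar>"
    using r by linarith
  then obtain w where w: "w = u \<or> w = v" "r \<le> \<bar>g t - g w\<bar>"
    by blast
  have tw: "t \<le> w" "w \<le> v"
    using w(1) t uv by auto
  have "continuous_on {t..w} (\<lambda>x. \<bar>g t - g x\<bar>)"
    by (intro continuous_intros continuous_on_subset[OF g]) (use t tw uv in auto)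
  then obtain s where s: "t \<le> s" "s \<le> w" "\<bar>g t - g s\<bar> = r"
    using IVT'[of "\<lambda>x. \<bar>g t - g x\<bar>" t r w] tw w(2) r(1) by auto
  then have "t \<noteq> s"
    using r(1) by auto
  then show thesis
    using that[of s] s tw by auto
qed

lemma card_less_Suc_split:
  "card {i. i < Suc n \<and> P i} = (if P 0 then 1 else 0) + card {i. i < n \<and> P (Suc i)}"
proof -
  have "{i. i < Suc n \<and> P i} = (if P 0 then {0} else {}) \<union> Suc ` {i. i < n \<and> P (Suc i)}"
    by (auto simp: image_iff less_Suc_eq_0_disj)
  then show ?thesis
    by (auto simp: card_Un_disjoint card_image)
qed

text \<open>
  The starting point \<open>t\<close> must be free to lie anywhere to the left of \<open>x\<close> for the induction to go
  through: the exact step gained from one large increment may end strictly before the right end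
  point of that increment.
\<close>

lemma exact_chain:
  fixes g :: "real \<Rightarrow> real"
  assumes g: "continuous_on {0..1} g" and r: "0 < r"
  assumes "finite_partition (x # xs)" "0 \<le> t" "t \<le> x"
  shows "\<exists>ys. finite_partition (t # ys)
    \<and> (\<forall>i<length ys. \<bar>g ((t # ys) ! i) - g ((t # ys) ! Suc i)\<bar> = r)
    \<and> length ys = card {i. i < length xs \<and> 2 * r \<le> \<bar>g ((x # xs) ! i) - g ((x # xs) ! Suc i)\<bar>}"
  using assms(3-)
proof (induction xs arbitrary: x t)
  case Nil
  then show ?case
    by (auto simp: finite_partition_def)
next
  case (Cons y xs)
  let ?P = "\<lambda>i. 2 * r \<le> \<bar>g ((x # y # xs) ! i) - g ((x # y # xs) ! Suc i)\<bar>"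
  have part: "finite_partition (y # xs)" and xy: "x < y" "y \<le> 1"
    using Cons.prems(1) by (auto simp: finite_partition_def)
  note count = card_less_Suc_split[of "length xs" ?P]
  show ?case
  proof (cases "2 * r \<le> \<bar>g x - g y\<bar>")
    case False
    then show ?thesis
      using Cons.IH[OF part Cons.prems(2)] Cons.prems(3) xy(1) count by simp
  next
    case True
    obtain s where s: "t < s" "s \<le> y" "\<bar>g t - g s\<bar> = r"
      using exact_step[OF g Cons.prems(2,3) xy r True] .
    obtain ys where ys: "finite_partition (s # ys)"
      "\<forall>i<length ys. \<bar>g ((s # ys) ! i) - g ((s # ys) ! Suc i)\<bar> = r"
      "length ys = card {i. i < length xs \<and> ?P (Suc i)}"
      using Cons.IH[OF part _ s(2)] s(1) Cons.prems(2) by auto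
    have "finite_partition (t # s # ys)"
      using ys(1) s Cons.prems(2) by (auto simp: finite_partition_def)
    moreover have "\<forall>i<length (s # ys). \<bar>g ((t # s # ys) ! i) - g ((t # s # ys) ! Suc i)\<bar> = r"
      using ys(2) s(3) by (auto simp: less_Suc_eq_0_disj)
    moreover have "length (s # ys) = card {i. i < length (y # xs) \<and> ?P i}"
      using ys(3) count True by simp
    ultimately show ?thesis
      by blast
  qed
qed

lemma card_large_increments_le_pr_variation:
  fixes g :: "real \<Rightarrow> real"
  assumes g: "continuous_on {0..1} g" and r: "0 < r" and xs: "finite_partition xs"
  shows "ennreal (real (card {i. i < length xs - 1 \<and> 2 * r \<le> \<bar>g (xs ! i) - g (xs ! Suc i)\<bar>})
      * r powr q) \<le> pr_variation q r g"
proof (cases xs)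
  case Nil
  then show ?thesis
    by simp
next
  case (Cons x zs)
  then have "0 \<le> x"
    using xs by (auto simp: finite_partition_def)
  then obtain ys where ys: "finite_partition (x # ys)"
    "\<forall>i<length ys. \<bar>g ((x # ys) ! i) - g ((x # ys) ! Suc i)\<bar> = r"
    "length ys = card {i. i < length xs - 1 \<and> 2 * r \<le> \<bar>g (xs ! i) - g (xs ! Suc i)\<bar>}"
    using exact_chain[OF g r xs[unfolded Cons], of x] unfolding Cons by auto
  have "variation_sum q g (x # ys) = (\<Sum>i<length ys. r powr q)"
    unfolding variation_sum_def using ys(2) by (intro sum.cong) auto
  then have "variation_sum q g (x # ys) = real (length ys) * r powr q"
    by simp
  moreover have "ennreal (variation_sum q g (x # ys)) \<le> pr_variation q r g"
    unfolding pr_variation_def using ys(1,2) by (intro SUP_upper) auto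
  ultimately show ?thesis
    using ys(3) by simp
qed

section \<open>Dyadic summation\<close>

lemma dyadic_scale:
  fixes d M :: real
  assumes "0 < d" "d \<le> M"
  obtains k :: nat where "M * (1/2) ^ k \<le> d" "d \<le> 2 * M * (1/2) ^ k"
proof -
  define Q where "Q = (\<lambda>k::nat. M * (1/2) ^ k \<le> d)"
  have "\<exists>k::nat. (1/2) ^ k < d / M"
    using assms by (intro real_arch_pow_inv) auto
  then obtain k0 where "Q k0"
    using assms by (auto simp: Q_def field_simps intro: less_imp_le)
  then have Q: "Q (LEAST k. Q k)"
    by (rule LeastI)
  show thesis
  proof (cases "LEAST k. Q k")
    case 0
    then show ?thesis
      using that[of 0] Q assms by (simp add: Q_def)
  next
    case (Suc j)
    then have "\<not> Q j"
      using not_less_Least[of j Q] by simp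
    then show ?thesis
      using that[of "Suc j"] Q Suc by (simp add: Q_def)
  qed
qed

lemma power_powr_commute: "0 < x \<Longrightarrow> (x ^ k) powr p = (x powr p) ^ k" for x p :: real
  by (simp add: powr_powr powr_realpow[symmetric] mult.commute)

text \<open>
  The bound depends neither on the number of terms nor on the size of the smallest one; this is what
  makes it uniform over all partitions.
\<close>

lemma sum_powr_le_of_dyadic_count:
  fixes d :: "'a \<Rightarrow> real"
  assumes "finite I" and M: "0 < M" and pq: "q < p" "0 \<le> p"
    and d: "\<And>i. i \<in> I \<Longrightarrow> 0 \<le> d i \<and> d i \<le> M"
    and count: "\<And>k::nat. real (card {i\<in>I. M * (1/2) ^ k \<le> d i}) \<le> L * (2 powr q) ^ k"
  shows "(\<Sum>i\<in>I. d i powr p) \<le> (\<Sum>k. L * (2 * M) powr p * (2 powr (q - p)) ^ k)"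
proof -
  define J where "J = {i\<in>I. d i \<noteq> 0}"
  have J: "finite J"
    using \<open>finite I\<close> by (simp add: J_def)
  have "\<forall>i\<in>J. \<exists>k::nat. M * (1/2) ^ k \<le> d i \<and> d i \<le> 2 * M * (1/2) ^ k"
  proof
    fix i assume "i \<in> J"
    then have "0 < d i" "d i \<le> M"
      using d[of i] by (auto simp: J_def)
    then show "\<exists>k::nat. M * (1/2) ^ k \<le> d i \<and> d i \<le> 2 * M * (1/2) ^ k"
      by (rule dyadic_scale) blast
  qed
  then obtain \<kappa> :: "'a \<Rightarrow> nat" where
    \<kappa>: "\<And>i. i \<in> J \<Longrightarrow> M * (1/2) ^ \<kappa> i \<le> d i \<and> d i \<le> 2 * M * (1/2) ^ \<kappa> i"
    by metis
  have "2 powr (q - p) < 2 powr 0"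
    using pq by (intro powr_less_mono) auto
  then have ratio: "norm (2 powr (q - p)) < 1"
    by simp
  have "0 \<le> L"
    using count[of 0] of_nat_0_le_iff order_trans by fastforce
  have layer: "(\<Sum>i\<in>{i\<in>J. \<kappa> i = k}. d i powr p) \<le> L * (2 * M) powr p * (2 powr (q - p)) ^ k" for k
  proof -
    have "(\<Sum>i\<in>{i\<in>J. \<kappa> i = k}. d i powr p) \<le> (\<Sum>i\<in>{i\<in>J. \<kappa> i = k}. (2 * M * (1/2) ^ k) powr p)"
      using \<kappa> d pq by (intro sum_mono powr_mono2) (auto simp: J_def)
    also have "\<dots> = real (card {i\<in>J. \<kappa> i = k}) * (2 * M * (1/2) ^ k) powr p"
      by simp
    also have "\<dots> \<le> real (card {i\<in>I. M * (1/2) ^ k \<le> d i}) * (2 * M * (1/2) ^ k) powr p"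
      using \<kappa> \<open>finite I\<close> by (intro mult_right_mono of_nat_mono card_mono) (auto simp: J_def)
    also have "\<dots> \<le> L * (2 powr q) ^ k * (2 * M * (1/2) ^ k) powr p"
      by (intro mult_right_mono count) auto
    also have "\<dots> = L * (2 * M) powr p * (2 powr q * (1/2) powr p) ^ k"
      using M by (simp add: powr_mult power_powr_commute power_mult_distrib)
    also have "2 powr q * (1/2) powr p = 2 powr (q - p)"
      by (simp add: powr_diff powr_divide)
    finally show ?thesis .
  qed
  have "(\<Sum>i\<in>I. d i powr p) = (\<Sum>i\<in>J. d i powr p)"
    using \<open>finite I\<close> by (intro sum.mono_neutral_right) (auto simp: J_def)
  also have "\<dots> = (\<Sum>k\<in>\<kappa> ` J. \<Sum>i\<in>{i\<in>J. \<kappa> i = k}. d i powr p)"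
    using J by (rule sum.image_gen)
  also have "\<dots> \<le> (\<Sum>k\<in>\<kappa> ` J. L * (2 * M) powr p * (2 powr (q - p)) ^ k)"
    by (intro sum_mono layer)
  also have "\<dots> \<le> (\<Sum>k. L * (2 * M) powr p * (2 powr (q - p)) ^ k)"
    using J \<open>0 \<le> L\<close> ratio by (intro sum_le_suminf summable_mult summable_geometric) auto
  finally show ?thesis .
qed

section \<open>Upper content and variation\<close>

lemma upper_variation_content_le_p_variation:
  "upper_variation_content p g \<le> p_variation p g"
proof -
  have "pr_variation p r g \<le> p_variation p g" for r
    unfolding pr_variation_def p_variation_def by (rule SUP_subset_mono) auto
  then show ?thesis
    unfolding upper_variation_content_def by (intro Limsup_bounded always_eventually allI)
qed

lemma p_variation_finite_of_upper_content_finite: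
  fixes g :: "real \<Rightarrow> real"
  assumes g: "continuous_on {0..1} g" and pq: "q < p" "0 \<le> p"
    and fin: "upper_variation_content q g < \<infinity>"
  shows "p_variation p g < \<infinity>"
proof -
  obtain c where c: "upper_variation_content q g < c" "c < \<infinity>"
    using dense[OF fin] by blast
  then obtain K where K: "0 \<le> K" "c = ennreal K"
    by (cases c) auto
  have "eventually (\<lambda>r. pr_variation q r g < c) (at_right 0)"
    using c(1) unfolding upper_variation_content_def by (rule Limsup_lessD)
  then obtain r0 where r0: "0 < r0" "\<And>r. 0 < r \<Longrightarrow> r < r0 \<Longrightarrow> pr_variation q r g < c"
    by (auto simp: eventually_at_right_field)
  have "continuous_on {0..1} (\<lambda>x. \<bar>g x\<bar>)"
    using g by (intro continuous_intros)
  from continuous_attains_sup[OF compact_Icc _ this] obtain B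
    where B: "\<And>x. x \<in> {0..1} \<Longrightarrow> \<bar>g x\<bar> \<le> B"
    by (metis atLeastAtMost_iff empty_iff order_refl zero_le_one)
  define M where "M = 2 * B + 1"
  have M: "0 < M"
    using B[of 0] by (auto simp: M_def)
  \<comment> \<open>The scales at which exact partitions are counted are \<open>\<delta> / 2 ^ k\<close>: all of them lie below \<open>r0\<close>,
    and an increment of size at least \<open>M / 2 ^ k\<close> is at least twice the scale \<open>\<delta> / 2 ^ k\<close>.\<close>
  define \<delta> where "\<delta> = min (r0 / 2) (M / 2)"
  have \<delta>: "0 < \<delta>" "\<delta> < r0" "2 * \<delta> \<le> M"
    using r0(1) M by (auto simp: \<delta>_def)
  define C where "C = (\<Sum>k. K * \<delta> powr (-q) * (2 * M) powr p * (2 powr (q - p)) ^ k)"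
  have "variation_sum p g xs \<le> C" if xs: "finite_partition xs" for xs
  proof -
    define d where "d i = \<bar>g (xs ! i) - g (xs ! Suc i)\<bar>" for i
    have bound: "0 \<le> d i \<and> d i \<le> M" if "i \<in> {..<length xs - 1}" for i
    proof -
      have "xs ! i \<in> set xs" "xs ! Suc i \<in> set xs"
        using that by auto
      then have "xs ! i \<in> {0..1}" "xs ! Suc i \<in> {0..1}"
        using xs unfolding finite_partition_def by blast+
      then show ?thesis
        using B[of "xs ! i"] B[of "xs ! Suc i"] by (auto simp: d_def M_def)
    qed
    have count: "real (card {i\<in>{..<length xs - 1}. M * (1/2) ^ k \<le> d i})
        \<le> K * \<delta> powr (-q) * (2 powr q) ^ k" for k :: nat
    proof -
      define r where "r = \<delta> * (1/2) ^ k"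
      define N where "N = card {i. i < length xs - 1 \<and> 2 * r \<le> d i}"
      have "\<delta> * (1/2) ^ k \<le> \<delta> * 1"
        using \<delta>(1) by (intro mult_left_mono power_le_one) auto
      then have r: "0 < r" "r < r0"
        using \<delta>(1,2) unfolding r_def by (simp, linarith)
      have "2 * r \<le> M * (1/2) ^ k"
        using mult_right_mono[OF \<delta>(3), of "(1/2) ^ k"] by (simp add: r_def)
      then have "card {i\<in>{..<length xs - 1}. M * (1/2) ^ k \<le> d i} \<le> N"
        unfolding N_def by (intro card_mono) auto
      moreover have "ennreal (real N * r powr q) \<le> ennreal K"
        using card_large_increments_le_pr_variation[OF g r(1) xs, of q] r0(2)[OF r]
        unfolding N_def d_def K(2) by (rule order_trans[OF _ less_imp_le])
      then have "real N * r powr q \<le> K"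
        using K(1) by (simp add: ennreal_le_iff)
      then have "real N \<le> K / r powr q"
        using r by (simp add: field_simps)
      moreover have "K / r powr q = K * \<delta> powr (-q) * (2 powr q) ^ k"
        using \<delta>(1) by (simp add: r_def powr_mult power_powr_commute powr_minus powr_divide field_simps)
      ultimately show ?thesis
        by linarith
    qed
    have "(\<Sum>i<length xs - 1. d i powr p) \<le> C"
      unfolding C_def by (rule sum_powr_le_of_dyadic_count[OF _ M pq bound count]) auto
    then show ?thesis
      by (simp add: variation_sum_def d_def)
  qed
  then have "p_variation p g \<le> ennreal C"
    unfolding p_variation_def by (intro SUP_least ennreal_leI) auto
  also have "\<dots> < \<infinity>"
    by simp
  finally show ?thesis .
qed

text \<open>
  Infinite \<open>p\<close>-variation only yields infinite upper content of the orders \<open>q < p\<close>, but a supremum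
  does not see the lost end point. For \<open>p = 1\<close> no admissible \<open>q\<close> is left; there the convention that
  both indices are at least \<open>1\<close> is what closes the gap.
\<close>

theorem upper_variation_index_eq_variation_index:
  fixes g :: "real \<Rightarrow> real"
  assumes g: "continuous_on {0..1} g"
  shows "upper_variation_index g = variation_index g"
proof -
  define P where "P = {p::real. 1 \<le> p \<and> p_variation p g = \<infinity>}"
  define U where "U = {p::real. 1 \<le> p \<and> upper_variation_content p g = \<infinity>}"
  define \<iota> where "\<iota> A = (if A = {} then 1 else SUP p\<in>A. ereal p)" for A :: "real set"
  have mem: "ereal p \<le> \<iota> A" if "p \<in> A" for p A
    using that by (auto simp: \<iota>_def intro: SUP_upper)
  have one: "1 \<le> \<iota> A" if "A \<subseteq> {1..}" for A
  proof (cases "A = {}")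
    case False
    then obtain p where "p \<in> A" by blast
    then have "1 \<le> ereal p"
      using that by (auto simp: one_ereal_def)
    then show ?thesis
      using mem[OF \<open>p \<in> A\<close>] by (rule order_trans)
  qed (simp add: \<iota>_def)
  have least: "\<iota> A \<le> y" if "1 \<le> y" "\<And>p. p \<in> A \<Longrightarrow> ereal p \<le> y" for A y
    using that by (auto simp: \<iota>_def intro: SUP_least)
  have "U \<subseteq> P"
    using upper_variation_content_le_p_variation[of _ g]
    by (auto simp: U_def P_def) (metis top_unique)
  then have "\<iota> U \<le> \<iota> P"
    using mem[of _ P] one[of P] by (intro least) (auto simp: P_def)
  moreover have "\<iota> P \<le> \<iota> U"
  proof (rule least)
    show one_U: "1 \<le> \<iota> U"
      by (rule one) (auto simp: U_def)
    fix p assume p: "p \<in> P"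
    show "ereal p \<le> \<iota> U"
    proof (cases "p = 1")
      case True
      then show ?thesis
        using one_U by (simp add: one_ereal_def)
    next
      case False
      have below: "ereal q \<le> \<iota> U" if "1 < q" "q < p" for q
      proof -
        have "\<not> upper_variation_content q g < \<infinity>"
          using p_variation_finite_of_upper_content_finite[OF g, of q p] that p by (auto simp: P_def)
        then show ?thesis
          using that by (intro mem) (auto simp: U_def less_top[symmetric])
      qed
      show ?thesis
      proof (cases "\<iota> U")
        case (real u)
        have "p \<le> u"
          using below False p by (intro dense_le_bounded[of 1 p]) (auto simp: real P_def)
        then show ?thesis
          using real by simp
      qed (use one_U in auto)
    qed
  qed
  ultimately show ?thesis
    by (simp add: upper_variation_index_def variation_index_def \<iota>_def P_def U_def Let_def)
qed

section \<open>Functions on the circle\<close>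

lemma continuous_on_excursion:
  assumes f: "circle_continuous f" and a: "a \<in> {0..1}"
  shows "continuous_on {0..1} (excursion f a)"
proof -
  have cont: "continuous_on {0..1} f" and ends: "f 0 = f 1"
    using f by (auto simp: circle_continuous_def)
  \<comment> \<open>At an integer \<open>frac\<close> jumps from \<open>1\<close> to \<open>0\<close>, which \<open>f\<close> does not notice.\<close>
  have f_frac: "f (frac y) = f (y - of_int n)" if "of_int n \<le> y" "y \<le> of_int n + 1" for y n
  proof (cases "y = of_int n + 1")
    case True
    then show ?thesis
      using ends by simp
  next
    case False
    then have "\<lfloor>y\<rfloor> = n"
      using that by (intro floor_unique) auto
    then show ?thesis
      by (simp add: frac_def)
  qed
  have "continuous_on {0..1 - a} (excursion f a)"
  proof (rule continuous_on_cong[THEN iffD1, OF refl])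
    show "continuous_on {0..1 - a} (\<lambda>x. f (x + a) - f a)"
      by (intro continuous_intros continuous_on_compose2[OF cont]) (use a in auto)
  qed (use a f_frac[of 0] in \<open>auto simp: excursion_def\<close>)
  moreover have "continuous_on {1 - a..1} (excursion f a)"
  proof (rule continuous_on_cong[THEN iffD1, OF refl])
    show "continuous_on {1 - a..1} (\<lambda>x. f (x + a - 1) - f a)"
      by (intro continuous_intros continuous_on_compose2[OF cont]) (use a in auto)
  qed (use a f_frac[of 1] in \<open>auto simp: excursion_def\<close>)
  ultimately have "continuous_on ({0..1 - a} \<union> {1 - a..1}) (excursion f a)"
    by (intro continuous_on_closed_Un) auto
  moreover have "{0..1 - a} \<union> {1 - a..1} = {0..1}"
    using a by auto
  ultimately show ?thesis
    by simp
qed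

theorem lemma4p5:
  fixes f :: "real \<Rightarrow> real" and a :: real
  assumes "circle_continuous f"
    and "circle_minimum_at f a"
  shows "(\<forall>p\<ge>1. upper_variation_content p (excursion f a) \<le> p_variation p (excursion f a))
    \<and> upper_variation_index (excursion f a) = variation_index (excursion f a)"
proof -
  have "continuous_on {0..1} (excursion f a)"
    using assms by (intro continuous_on_excursion) (auto simp: circle_minimum_at_def)
  then show ?thesis
    by (simp add: upper_variation_content_le_p_variation upper_variation_index_eq_variation_index)
qed

end
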